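(* Let $\theta_{\min}:=\inf_{j\in T_0}|\theta_{0j}|$ and $c_n:=\|\psi_n^{(1)}(\hat{\boldsymbol\theta}_n^{(1)})-\psi_n^{(1)}(\boldsymbol\theta_0)\|_\infty$. Assume that: (a) $\mathrm P(\|\psi_n^{(1)}(\boldsymbol\theta_0)\|_\infty>\lambda_n)\to0$ as $n\to\infty$; (b) there exists a constant $\delta>0$ such that $\mathrm P(F_\infty(T_0,\boldsymbol V_n^{(1)})>\delta)\to1$ as $n\to\infty$; (c) $\theta_{\min}>4c_n/\delta$. Then $$\mathrm P\Big(\|\hat{\boldsymbol\theta}_n^{(1)}-\boldsymbol\theta_0\|_\infty>\tfrac2\delta c_n\Big)\to0,\qquad n\to\infty,$$ and in particular $\|\hat{\boldsymbol\theta}_n^{(1)}-\boldsymbol\theta_0\|_\infty=O_p(\lambda_n)$ as $n\to\infty$. Moreover, if the threshold $\tau_n$ satisfies $2c_n/\delta<\tau_n<\theta_{\min}/2$, then $\mathrm P(\hat T_n=T_0)\to1$ as $n\to\infty$.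
   Context: Model: for each $n$, $Y_t=\boldsymbol\theta_0^\top\boldsymbol Z_t+\epsilon_t$, $t=1,\dots,n$, where $Y_t$ is real-valued, $\{\boldsymbol Z_t\}$ is i.i.d. $\mathbb R^p$-valued with finite variance, and $\{\epsilon_t\}$ is an independent sequence with $\mathrm E[\epsilon_t|\boldsymbol Z_t]=0$, $\mathrm E[\epsilon_t^2|\boldsymbol Z_t]=\sigma^2(\boldsymbol Z_t;h_0)$ for a measurable function $\sigma$ and a nuisance parameter $h_0\in H$ ($H$ a metric space). The dimension $p$ may depend on $n$ and tend to infinity. The true parameter is $\boldsymbol\theta_0\in\Theta\subset\mathbb R^p$, with support $T_0=\{j:\theta_{0j}\ne0\}$; its cardinality $s$ is smaller than $n$ and $p$ (and may depend on $n$). Score: $\psi_n^{(1)}(\boldsymbol\theta)=\frac1n\sum_{t=1}^n\boldsymbol Z_t(Y_t-\boldsymbol\theta^\top\boldsymbol Z_t)$. Dantzig selector: given a tuning parameter $\lambda_n$, $\hat{\boldsymbol\theta}_n^{(1)}$ is a (measurable) minimizer of $\|\boldsymbol\theta\|_1$ over $\mathcal C_n=\{\boldsymbol\theta\in\Theta:\|\psi_n^{(1)}(\boldsymbol\theta)\|_\infty\le\lambda_n\}$; a minimizer is taken to exist whenever $\mathcal C_n\neq\emptyset$. Given a threshold $\tau_n$ (possibly depending on $n,p,s$), $\hat T_n=\{j:|\hat\theta^{(1)}_{nj}|>\tau_n\}$. For an index set $T$, $\boldsymbol v_T$ is the sub-vector of $\boldsymbol v$ with indices in $T$; $C_{T}=\{\boldsymbol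 v\in\mathbb R^p:\|\boldsymbol v_{T^c}\|_1\le\|\boldsymbol v_T\|_1\}$. $\boldsymbol V_n^{(1)}$ is a (random) $p\times p$ matrix such that for every $\boldsymbol\theta\in\Theta$ with $\boldsymbol v:=\boldsymbol\theta-\boldsymbol\theta_0\in C_{T_0}$: $|\boldsymbol v^\top[\psi_n^{(1)}(\boldsymbol\theta)-\psi_n^{(1)}(\boldsymbol\theta_0)]|\ge|\boldsymbol v^\top\boldsymbol V_n^{(1)}\boldsymbol v|$. For $\boldsymbol M\in\mathbb R^{p\times p}$: $F_\infty(T_0,\boldsymbol M)=\inf_{\boldsymbol v\in C_{T_0}\setminus\{\boldsymbol0\}}\frac{|\boldsymbol v^\top\boldsymbol M\boldsymbol v|}{\|\boldsymbol v_{T_0}\|_1\|\boldsymbol v\|_\infty}$. Inequalities involving the random quantity $c_n$ are understood to hold almost surely for every $n$. *)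

theory Defs
  imports "HOL-Probability.Probability"
begin

text \<open>
  The dimension \<open>p\<close> varies with the sample size, so it cannot be a type. Vectors of length \<open>p\<close> are
  the functions \<open>nat \<Rightarrow> real\<close> in \<open>{..<p} \<rightarrow>\<^sub>E UNIV\<close>, which is the space of
  \<open>Pi\<^sub>M {..<p} (\<lambda>_. borel)\<close>; vector-valued operations therefore produce restricted functions.
  Coordinates are numbered from 0, observations from 1.
\<close>

abbreviation Rvec :: "nat \<Rightarrow> (nat \<Rightarrow> real) measure" where
  "Rvec p \<equiv> Pi\<^sub>M {..<p} (\<lambda>_. borel)"

definition vzero :: "nat \<Rightarrow> nat \<Rightarrow> real" where
  "vzero p = (\<lambda>j\<in>{..<p}. 0)"

definition vdiff :: "nat \<Rightarrow> (nat \<Rightarrow> real) \<Rightarrow> (nat \<Rightarrow> real) \<Rightarrow> nat \<Rightarrow> real" where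
  "vdiff p u v = (\<lambda>j\<in>{..<p}. u j - v j)"

definition dotp :: "nat \<Rightarrow> (nat \<Rightarrow> real) \<Rightarrow> (nat \<Rightarrow> real) \<Rightarrow> real" where
  "dotp p u v = (\<Sum>j<p. u j * v j)"

definition matvec :: "nat \<Rightarrow> (nat \<Rightarrow> nat \<Rightarrow> real) \<Rightarrow> (nat \<Rightarrow> real) \<Rightarrow> nat \<Rightarrow> real" where
  "matvec p A v = (\<lambda>i\<in>{..<p}. \<Sum>j<p. A i j * v j)"

text \<open>\<open>l1norm I v\<close> is the 1-norm of the sub-vector of \<open>v\<close> with indices in \<open>I\<close>.\<close>

definition l1norm :: "nat set \<Rightarrow> (nat \<Rightarrow> real) \<Rightarrow> real" where
  "l1norm I v = (\<Sum>j\<in>I. \<bar>v j\<bar>)"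

text \<open>Only meaningful for \<open>p > 0\<close>.\<close>

definition linfnorm :: "nat \<Rightarrow> (nat \<Rightarrow> real) \<Rightarrow> real" where
  "linfnorm p v = (MAX j\<in>{..<p}. \<bar>v j\<bar>)"

definition vsupport :: "nat \<Rightarrow> (nat \<Rightarrow> real) \<Rightarrow> nat set" where
  "vsupport p v = {j. j < p \<and> v j \<noteq> 0}"

text \<open>The infimum is taken in \<open>ereal\<close>, so that it is \<open>\<infinity>\<close> when \<open>v = 0\<close>.\<close>

definition min_signal :: "nat \<Rightarrow> (nat \<Rightarrow> real) \<Rightarrow> ereal" where
  "min_signal p v = (INF j\<in>vsupport p v. ereal \<bar>v j\<bar>)"

definition score :: "nat \<Rightarrow> nat \<Rightarrow> (nat \<Rightarrow> nat \<Rightarrow> real) \<Rightarrow> (nat \<Rightarrow> real) \<Rightarrow> (nat \<Rightarrow> real) \<Rightarrow> nat \<Rightarrow> real" where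
  "score n p z y \<theta> = (\<lambda>j\<in>{..<p}. (1 / real n) * (\<Sum>t=1..n. z t j * (y t - dotp p \<theta> (z t))))"

definition dantzig_set :: "(nat \<Rightarrow> real) set \<Rightarrow> nat \<Rightarrow> ((nat \<Rightarrow> real) \<Rightarrow> nat \<Rightarrow> real) \<Rightarrow> real \<Rightarrow> (nat \<Rightarrow> real) set" where
  "dantzig_set \<Theta> p \<psi> l = {\<theta>\<in>\<Theta>. linfnorm p (\<psi> \<theta>) \<le> l}"

text \<open>The estimate is arbitrary when the feasible set is empty.\<close>

definition is_dantzig_selector ::
  "(nat \<Rightarrow> real) set \<Rightarrow> nat \<Rightarrow> ((nat \<Rightarrow> real) \<Rightarrow> nat \<Rightarrow> real) \<Rightarrow> real \<Rightarrow> (nat \<Rightarrow> real) \<Rightarrow> bool" where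
  "is_dantzig_selector \<Theta> p \<psi> l \<theta> \<longleftrightarrow>
     (dantzig_set \<Theta> p \<psi> l \<noteq> {} \<longrightarrow>
        is_arg_min (l1norm {..<p}) (\<lambda>u. u \<in> dantzig_set \<Theta> p \<psi> l) \<theta>)"

definition threshold_set :: "nat \<Rightarrow> real \<Rightarrow> (nat \<Rightarrow> real) \<Rightarrow> nat set" where
  "threshold_set p \<tau> v = {j. j < p \<and> \<bar>v j\<bar> > \<tau>}"

definition l1cone :: "nat \<Rightarrow> nat set \<Rightarrow> (nat \<Rightarrow> real) set" where
  "l1cone p T = {v \<in> {..<p} \<rightarrow>\<^sub>E UNIV. l1norm ({..<p} - T) v \<le> l1norm T v}"

text \<open>
  The denominator is positive on the nonzero part of the cone. For \<open>T = {}\<close> the cone is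
  trivial and the infimum is \<open>\<infinity>\<close>.
\<close>

definition F_infty :: "nat \<Rightarrow> nat set \<Rightarrow> (nat \<Rightarrow> nat \<Rightarrow> real) \<Rightarrow> ereal" where
  "F_infty p T A =
     (INF v\<in>l1cone p T - {vzero p}.
        ereal (\<bar>dotp p v (matvec p A v)\<bar> / (l1norm T v * linfnorm p v)))"

text \<open>
  Sample size \<open>n\<close>, dimension \<open>p\<close>, true parameter \<open>\<theta>0\<close>. The conditional second
  moment is a nonnegative conditional expectation, so that square integrability of the errors
  need not be assumed.
\<close>

definition linear_model ::
  "'a measure \<Rightarrow> nat \<Rightarrow> nat \<Rightarrow> (nat \<Rightarrow> real) \<Rightarrow> (nat \<Rightarrow> 'a \<Rightarrow> nat \<Rightarrow> real) \<Rightarrow> (nat \<Rightarrow> 'a \<Rightarrow> real) \<Rightarrow>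
   (nat \<Rightarrow> 'a \<Rightarrow> real) \<Rightarrow> 'h::metric_space set \<Rightarrow> ((nat \<Rightarrow> real) \<Rightarrow> 'h \<Rightarrow> real) \<Rightarrow> 'h \<Rightarrow> bool" where
  "linear_model M n p \<theta>0 Z Y \<epsilon> H \<sigma> h0 \<longleftrightarrow>
     prob_space M \<and>
     prob_space.indep_vars M (\<lambda>_. Rvec p) Z {1..n} \<and>
     (\<forall>t\<in>{1..n}. \<forall>t'\<in>{1..n}. distr M (Rvec p) (Z t) = distr M (Rvec p) (Z t')) \<and>
     (\<forall>t\<in>{1..n}. \<forall>j<p. integrable M (\<lambda>\<omega>. (Z t \<omega> j)\<^sup>2)) \<and>
     prob_space.indep_vars M (\<lambda>_. borel) \<epsilon> {1..n} \<and>
     (\<lambda>(z, h). \<sigma> z h) \<in> borel_measurable (Rvec p \<Otimes>\<^sub>M restrict_space borel H) \<and> h0 \<in> H \<and>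
     (\<forall>t\<in>{1..n}.
        integrable M (\<epsilon> t) \<and>
        (AE \<omega> in M. real_cond_exp M (vimage_algebra (space M) (Z t) (Rvec p)) (\<epsilon> t) \<omega> = 0) \<and>
        (AE \<omega> in M. nn_cond_exp M (vimage_algebra (space M) (Z t) (Rvec p)) (\<lambda>\<omega>. ennreal ((\<epsilon> t \<omega>)\<^sup>2)) \<omega>
                     = ennreal ((\<sigma> (Z t \<omega>) h0)\<^sup>2)) \<and>
        (\<forall>\<omega>\<in>space M. Y t \<omega> = dotp p \<theta>0 (Z t \<omega>) + \<epsilon> t \<omega>))"

definition bigO_prob :: "(nat \<Rightarrow> 'a measure) \<Rightarrow> (nat \<Rightarrow> 'a \<Rightarrow> real) \<Rightarrow> (nat \<Rightarrow> real) \<Rightarrow> bool" where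
  "bigO_prob M X a \<longleftrightarrow>
     (\<forall>\<eta>>0. \<exists>K>0. \<forall>\<^sub>F n in sequentially. measure (M n) {\<omega>\<in>space (M n). \<bar>X n \<omega>\<bar> > K * a n} < \<eta>)"

end

theory Submission
  imports Defs
begin

text \<open>
  If \<open>\<theta>\<^sub>0\<close> is feasible, minimality of the 1-norm puts \<open>v = \<theta>hat - \<theta>\<^sub>0\<close> in the cone \<open>C\<^bsub>T0\<^esub>\<close>. There
  \<open>\<parallel>v\<parallel>\<^sub>1 \<le> 2 \<parallel>v\<^bsub>T0\<^esub>\<parallel>\<^sub>1\<close>, and Hoelder's inequality bounds \<open>\<bar>v\<^sup>T V v\<bar>\<close> by \<open>\<parallel>v\<parallel>\<^sub>1 c\<^sub>n\<close>, so that
  \<open>F\<^sub>\<infinity> > \<delta>\<close> gives \<open>\<delta> \<parallel>v\<parallel>\<^sub>\<infinity> \<le> 2 c\<^sub>n\<close>. Feasibility of both vectors yields \<open>c\<^sub>n \<le> 2 \<lambda>\<^sub>n\<close>. All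
  three claims hold on the intersection of the two events in (a) and (b).
\<close>

section \<open>Maximum norm and Hoelder's inequality\<close>

lemma linfnorm_le_iff:
  assumes "p > 0"
  shows "linfnorm p v \<le> l \<longleftrightarrow> (\<forall>j<p. \<bar>v j\<bar> \<le> l)"
  using assms unfolding linfnorm_def by (subst Max_le_iff) auto

lemma abs_le_linfnorm: "j < p \<Longrightarrow> \<bar>v j\<bar> \<le> linfnorm p v"
  unfolding linfnorm_def by (rule Max_ge) auto

lemma linfnorm_nonneg:
  assumes "p > 0"
  shows "0 \<le> linfnorm p v"
  using abs_le_linfnorm[OF assms, of v] by linarith

lemma linfnorm_vdiff_le:
  assumes "p > 0"
  shows "linfnorm p (vdiff p u v) \<le> linfnorm p u + linfnorm p v"
  unfolding linfnorm_le_iff[OF assms]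
proof (intro allI impI)
  fix j assume "j < p"
  then show "\<bar>vdiff p u v j\<bar> \<le> linfnorm p u + linfnorm p v"
    using abs_le_linfnorm[of j p u] abs_le_linfnorm[of j p v] by (simp add: vdiff_def)
qed

lemma abs_dotp_le: "\<bar>dotp p u v\<bar> \<le> l1norm {..<p} u * linfnorm p v"
proof -
  have "\<bar>dotp p u v\<bar> \<le> (\<Sum>j<p. \<bar>u j * v j\<bar>)"
    unfolding dotp_def by (rule sum_abs)
  also have "\<dots> \<le> (\<Sum>j<p. \<bar>u j\<bar> * linfnorm p v)"
    by (rule sum_mono) (auto simp: abs_mult intro: mult_left_mono abs_le_linfnorm)
  finally show ?thesis
    by (simp add: l1norm_def sum_distrib_right)
qed

section \<open>The cone and the factor \<open>F_infty\<close>\<close>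

lemma l1norm_split:
  assumes "T \<subseteq> {..<p}"
  shows "l1norm {..<p} v = l1norm T v + l1norm ({..<p} - T) v"
  unfolding l1norm_def using sum.subset_diff[OF assms, of "\<lambda>j. \<bar>v j\<bar>"] by simp

text \<open>Off the support \<open>?T\<close> of \<open>v\<close> the difference coincides with
  \<open>u\<close>. Its 1-norm there is the 1-norm of \<open>u\<close> minus the part on
  \<open>?T\<close>, hence at most that of \<open>v\<close> minus the part of \<open>u\<close> on
  \<open>?T\<close>; the triangle inequality on \<open>?T\<close> finishes.\<close>

lemma vdiff_mem_l1cone:
  assumes "l1norm {..<p} u \<le> l1norm {..<p} v"
  shows "vdiff p u v \<in> l1cone p (vsupport p v)"
proof -
  let ?T = "vsupport p v"
  have T: "?T \<subseteq> {..<p}"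
    by (auto simp: vsupport_def)
  have off: "l1norm ({..<p} - ?T) (vdiff p u v) = l1norm ({..<p} - ?T) u"
    unfolding l1norm_def by (rule sum.cong) (auto simp: vdiff_def vsupport_def)
  have zero: "l1norm ({..<p} - ?T) v = 0"
    unfolding l1norm_def by (rule sum.neutral) (auto simp: vsupport_def)
  have "l1norm ?T v \<le> l1norm ?T u + l1norm ?T (vdiff p u v)"
    unfolding l1norm_def sum.distrib[symmetric]
    by (rule sum_mono) (auto simp: vdiff_def vsupport_def)
  then have "l1norm ({..<p} - ?T) (vdiff p u v) \<le> l1norm ?T (vdiff p u v)"
    using assms l1norm_split[OF T, of u] l1norm_split[OF T, of v] off zero by linarith
  then show ?thesis
    by (auto simp: l1cone_def vdiff_def)
qed

text \<open>A lower bound on the quadratic form from \<open>F_infty\<close> meets the Hoelder upper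
  bound on \<open>dotp p v w\<close>, and the common factor \<open>l1norm T v\<close> cancels. Later
  \<open>w\<close> is the score difference whose maximum norm is \<open>c n\<close>.\<close>

lemma linfnorm_le_of_F_infty:
  assumes p: "p > 0" and T: "T \<subseteq> {..<p}" and v: "v \<in> l1cone p T"
    and F: "F_infty p T A > ereal \<delta>" and \<delta>: "\<delta> > 0"
    and A: "\<bar>dotp p v (matvec p A v)\<bar> \<le> \<bar>dotp p v w\<bar>"
  shows "linfnorm p v \<le> 2 / \<delta> * linfnorm p w"
\<comment> \<open>The zero vector is excluded from the infimum, so it is settled directly.\<close>
proof (cases "v = vzero p")
  case True
  then have "linfnorm p v \<le> 0"
    by (simp add: linfnorm_le_iff[OF p] vzero_def)
  moreover have "0 \<le> 2 / \<delta> * linfnorm p w"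
    using \<delta> linfnorm_nonneg[OF p, of w] by simp
  ultimately show ?thesis by linarith
next
  case False
  from v have ext: "v \<in> {..<p} \<rightarrow>\<^sub>E UNIV"
    and cone: "l1norm ({..<p} - T) v \<le> l1norm T v"
    by (auto simp: l1cone_def)
  \<comment> \<open>Elements of the cone are extensional: if all coordinates below \<open>p\<close>
    vanished, \<open>v\<close> would equal \<open>vzero p\<close> as a function.\<close>
  obtain j where j: "j < p" "v j \<noteq> 0"
  proof -
    have "\<exists>j<p. v j \<noteq> 0"
    proof (rule ccontr)
      assume "\<not> ?thesis"
      then have "v = vzero p"
        by (intro PiE_ext[OF ext]) (auto simp: vzero_def)
      with False show False by simp
    qed
    with that show ?thesis by blast
  qed
  \<comment> \<open>The 2 in the conclusion comes from here: on the cone the part off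
    \<open>T\<close> is dominated by the part on \<open>T\<close>.\<close>
  have l1: "l1norm {..<p} v \<le> 2 * l1norm T v"
    using cone l1norm_split[OF T, of v] by simp
  have "\<bar>v j\<bar> \<le> l1norm {..<p} v"
    unfolding l1norm_def using j by (intro member_le_sum) auto
  \<comment> \<open>A cone vector vanishing on \<open>T\<close> would vanish everywhere. So both
    factors of the denominator in \<open>F_infty\<close> are positive, and the quotient bound can be
    multiplied out.\<close>
  with l1 j have Tpos: "l1norm T v > 0" by linarith
  have vpos: "linfnorm p v > 0"
    using abs_le_linfnorm[OF j(1), of v] j(2) by linarith
  have "F_infty p T A \<le> ereal (\<bar>dotp p v (matvec p A v)\<bar> / (l1norm T v * linfnorm p v))"
    unfolding F_infty_def using v False by (intro INF_lower) auto
  with F have "ereal \<delta> < ereal (\<bar>dotp p v (matvec p A v)\<bar> / (l1norm T v * linfnorm p v))"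
    by (rule less_le_trans)
  then have "\<delta> * (l1norm T v * linfnorm p v) < \<bar>dotp p v (matvec p A v)\<bar>"
    using Tpos vpos by (simp add: pos_less_divide_eq)
  also have "\<dots> \<le> l1norm {..<p} v * linfnorm p w"
    using A abs_dotp_le[of p v w] by linarith
  also have "\<dots> \<le> 2 * l1norm T v * linfnorm p w"
    using l1 linfnorm_nonneg[OF p] by (rule mult_right_mono)
  finally have "l1norm T v * (\<delta> * linfnorm p v) < l1norm T v * (2 * linfnorm p w)"
    by (simp add: ac_simps)
  then have "\<delta> * linfnorm p v < 2 * linfnorm p w"
    using Tpos by simp
  then show ?thesis
    using \<delta> by (simp add: field_simps)
qed

section \<open>Deterministic support recovery and error bounds\<close>

text \<open>Each coordinate error is below \<open>\<tau>\<close>. Where \<open>v\<close> vanishes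
  this keeps \<open>u\<close> below the threshold; on the support \<open>v\<close> exceeds
  \<open>2 * \<tau>\<close> in absolute value, which leaves more than \<open>\<tau>\<close> for
  \<open>u\<close>.\<close>

lemma threshold_set_eq_vsupport:
  assumes close: "linfnorm p (vdiff p u v) \<le> r"
    and "r < \<tau>" and \<tau>: "ereal \<tau> < min_signal p v / 2"
  shows "threshold_set p \<tau> u = vsupport p v"
proof -
  have near: "\<bar>u j - v j\<bar> < \<tau>" if "j < p" for j
    using abs_le_linfnorm[OF that, of "vdiff p u v"] that assms(1,2) by (simp add: vdiff_def)
  have large: "2 * \<tau> < \<bar>v j\<bar>" if "j \<in> vsupport p v" for j
  proof -
    have "min_signal p v \<le> ereal \<bar>v j\<bar>"
      unfolding min_signal_def using that by (rule INF_lower)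
    then have "min_signal p v / 2 \<le> ereal \<bar>v j\<bar> / 2"
      by (rule ereal_divide_right_mono) simp
    with \<tau> have "ereal \<tau> < ereal \<bar>v j\<bar> / 2"
      by (rule less_le_trans)
    \<comment> \<open>Division agrees with real division once the extended-real numeral 2 is read as
      \<open>ereal 2\<close>.\<close>
    also have "ereal \<bar>v j\<bar> / 2 = ereal (\<bar>v j\<bar> / 2)"
      by (metis ereal_divide numeral_eq_ereal zero_neq_numeral)
    finally show ?thesis by simp
  qed
  show ?thesis
  proof (intro set_eqI iffI)
    fix j assume "j \<in> threshold_set p \<tau> u"
    then have j: "j < p" "\<tau> < \<bar>u j\<bar>" by (auto simp: threshold_set_def)
    with near[OF j(1)] show "j \<in> vsupport p v" by (auto simp: vsupport_def)
  next
    fix j assume j: "j \<in> vsupport p v"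
    then have "j < p" by (simp add: vsupport_def)
    with near[of j] large[OF j] show "j \<in> threshold_set p \<tau> u"
      by (auto simp: threshold_set_def)
  qed
qed

text \<open>The argument for one fixed outcome: \<open>\<psi>\<close> is the realized score map and
  \<open>l\<close> the tuning parameter. The constant 4 is the cone factor 2 times the 2 from the
  triangle inequality for two feasible scores.\<close>

lemma dantzig_selector_bounds:
  assumes p: "p > 0" and sel: "is_dantzig_selector \<Theta> p \<psi> l \<theta>" and "\<theta>0 \<in> \<Theta>"
    and feas: "linfnorm p (\<psi> \<theta>0) \<le> l"
    and F: "F_infty p (vsupport p \<theta>0) A > ereal \<delta>" and \<delta>: "\<delta> > 0"
    and A: "\<And>u v. u \<in> \<Theta> \<Longrightarrow> v = vdiff p u \<theta>0 \<Longrightarrow> v \<in> l1cone p (vsupport p \<theta>0) \<Longrightarrow>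
      \<bar>dotp p v (matvec p A v)\<bar> \<le> \<bar>dotp p v (vdiff p (\<psi> u) (\<psi> \<theta>0))\<bar>"
  shows "linfnorm p (vdiff p \<theta> \<theta>0) \<le> 2 / \<delta> * linfnorm p (vdiff p (\<psi> \<theta>) (\<psi> \<theta>0))"
    and "linfnorm p (vdiff p \<theta> \<theta>0) \<le> 4 / \<delta> * l"
proof -
  have mem: "\<theta>0 \<in> dantzig_set \<Theta> p \<psi> l"
    using \<open>\<theta>0 \<in> \<Theta>\<close> feas by (simp add: dantzig_set_def)
  \<comment> \<open>Feasibility of \<open>\<theta>0\<close> makes the constraint set nonempty, so
    the estimate is a genuine minimizer and not an arbitrary value.\<close>
  with sel have arg: "is_arg_min (l1norm {..<p}) (\<lambda>u. u \<in> dantzig_set \<Theta> p \<psi> l) \<theta>"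
    by (auto simp: is_dantzig_selector_def)
  then have \<theta>: "\<theta> \<in> \<Theta>" "linfnorm p (\<psi> \<theta>) \<le> l"
    by (auto simp: is_arg_min_def dantzig_set_def)
  have "l1norm {..<p} \<theta> \<le> l1norm {..<p} \<theta>0"
    using arg mem by (auto simp: is_arg_min_linorder)
  then have cone: "vdiff p \<theta> \<theta>0 \<in> l1cone p (vsupport p \<theta>0)"
    by (rule vdiff_mem_l1cone)
  show *: "linfnorm p (vdiff p \<theta> \<theta>0) \<le> 2 / \<delta> * linfnorm p (vdiff p (\<psi> \<theta>) (\<psi> \<theta>0))"
    by (rule linfnorm_le_of_F_infty[OF p _ cone F \<delta> A[OF \<theta>(1) refl cone]])
      (auto simp: vsupport_def)
  have "linfnorm p (vdiff p (\<psi> \<theta>) (\<psi> \<theta>0)) \<le> 2 * l"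
    using linfnorm_vdiff_le[OF p, of "\<psi> \<theta>" "\<psi> \<theta>0"] \<theta>(2) feas by linarith
  then have "2 / \<delta> * linfnorm p (vdiff p (\<psi> \<theta>) (\<psi> \<theta>0)) \<le> 2 / \<delta> * (2 * l)"
    using \<delta> by (intro mult_left_mono) auto
  with * show "linfnorm p (vdiff p \<theta> \<theta>0) \<le> 4 / \<delta> * l"
    by simp
qed

section \<open>Measurability of the events\<close>

lemma sets_linfnorm_le:
  assumes "p > 0" and "\<And>j. j < p \<Longrightarrow> (\<lambda>\<omega>. f \<omega> j) \<in> borel_measurable M"
  shows "{\<omega> \<in> space M. linfnorm p (f \<omega>) \<le> l} \<in> sets M"
proof -
  have "{\<omega> \<in> space M. \<forall>j\<in>{..<p}. \<bar>f \<omega> j\<bar> \<le> l} \<in> sets M"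
    using assms(2) by (intro sets.sets_Collect_finite_All) auto
  then show ?thesis
    unfolding linfnorm_le_iff[OF assms(1)] Ball_def lessThan_iff .
qed

text \<open>Measurability of \<open>Z\<close> and \<open>\<epsilon>\<close> is contained in
  \<open>indep_vars\<close>; that of \<open>Y\<close> follows from the model equation. The parameter
  \<open>\<theta>\<close> is fixed here, not random.\<close>

lemma score_measurable:
  assumes model: "linear_model M n p \<theta>0 Z Y \<epsilon> H \<sigma> h0" and j: "j < p"
  shows "(\<lambda>\<omega>. score n p (\<lambda>t. Z t \<omega>) (\<lambda>t. Y t \<omega>) \<theta> j) \<in> borel_measurable M"
proof -
  have "prob_space M" using model by (simp add: linear_model_def)
  then interpret prob_space M .
  have "indep_vars (\<lambda>_. Rvec p) Z {1..n}" "indep_vars (\<lambda>_. borel) \<epsilon> {1..n}"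
    using model by (simp_all add: linear_model_def)
  then have Zm: "Z t \<in> M \<rightarrow>\<^sub>M Rvec p" and em: "\<epsilon> t \<in> borel_measurable M" if "t \<in> {1..n}" for t
    using that unfolding indep_vars_def2 by auto
  have Zc: "(\<lambda>\<omega>. Z t \<omega> i) \<in> borel_measurable M" if "t \<in> {1..n}" "i < p" for t i
    using measurable_compose[OF Zm[OF that(1)] measurable_component_singleton[of i]] that by simp
  have dm: "(\<lambda>\<omega>. dotp p u (Z t \<omega>)) \<in> borel_measurable M" if "t \<in> {1..n}" for t u
    unfolding dotp_def using Zc[OF that] by (intro borel_measurable_sum borel_measurable_times) auto
  have Ym: "Y t \<in> borel_measurable M" if "t \<in> {1..n}" for t
  proof -
    have "(\<lambda>\<omega>. dotp p \<theta>0 (Z t \<omega>) + \<epsilon> t \<omega>) \<in> borel_measurable M"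
      using dm[OF that] em[OF that] by (rule borel_measurable_add)
    moreover have "\<And>\<omega>. \<omega> \<in> space M \<Longrightarrow> Y t \<omega> = dotp p \<theta>0 (Z t \<omega>) + \<epsilon> t \<omega>"
      using model that unfolding linear_model_def by blast
    ultimately show ?thesis by (simp add: measurable_cong[of M "Y t"])
  qed
  have "(\<lambda>\<omega>. (1 / real n) * (\<Sum>t=1..n. Z t \<omega> j * (Y t \<omega> - dotp p \<theta> (Z t \<omega>))))
      \<in> borel_measurable M"
    using Zc[OF _ j] dm Ym
    by (intro borel_measurable_times borel_measurable_const borel_measurable_sum
        borel_measurable_diff) auto
  then show ?thesis using j by (simp add: score_def)
qed

text \<open>Equality of the two index sets is a conjunction of \<open>p\<close> coordinatewise
  conditions. Measurability matters because the probability of this event is to be bounded from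
  below.\<close>

lemma sets_threshold_set_eq:
  assumes "f \<in> M \<rightarrow>\<^sub>M Rvec p"
  shows "{\<omega> \<in> space M. threshold_set p \<tau> (f \<omega>) = vsupport p v} \<in> sets M"
proof -
  have fc: "(\<lambda>\<omega>. f \<omega> i) \<in> borel_measurable M" if "i < p" for i
    using measurable_compose[OF assms measurable_component_singleton[of i]] that by simp
  have "{\<omega> \<in> space M. \<forall>j\<in>{..<p}. \<bar>f \<omega> j\<bar> > \<tau> \<longleftrightarrow> v j \<noteq> 0} \<in> sets M"
  proof (intro sets.sets_Collect_finite_All)
    fix j assume "j \<in> {..<p}"
    then have [measurable]: "(\<lambda>\<omega>. f \<omega> j) \<in> borel_measurable M" using fc by auto
    show "{\<omega> \<in> space M. \<bar>f \<omega> j\<bar> > \<tau> \<longleftrightarrow> v j \<noteq> 0} \<in> sets M" by measurable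
  qed auto
  also have "{\<omega> \<in> space M. \<forall>j\<in>{..<p}. \<bar>f \<omega> j\<bar> > \<tau> \<longleftrightarrow> v j \<noteq> 0}
      = {\<omega> \<in> space M. threshold_set p \<tau> (f \<omega>) = vsupport p v}"
    by (auto simp: threshold_set_def vsupport_def set_eq_iff)
  finally show ?thesis .
qed

section \<open>Passage to the limit in probability\<close>

theorem theorem2p2:
  fixes M :: "nat \<Rightarrow> 'a measure"
    and p :: "nat \<Rightarrow> nat"
    and \<Theta> :: "nat \<Rightarrow> (nat \<Rightarrow> real) set"
    and \<theta>0 :: "nat \<Rightarrow> nat \<Rightarrow> real"
    and Z :: "nat \<Rightarrow> nat \<Rightarrow> 'a \<Rightarrow> nat \<Rightarrow> real"
    and Y \<epsilon> :: "nat \<Rightarrow> nat \<Rightarrow> 'a \<Rightarrow> real"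
    and H :: "'h::metric_space set"
    and \<sigma> :: "nat \<Rightarrow> (nat \<Rightarrow> real) \<Rightarrow> 'h \<Rightarrow> real"
    and h0 :: 'h
    and lam \<tau> :: "nat \<Rightarrow> real"
    and \<theta>hat :: "nat \<Rightarrow> 'a \<Rightarrow> nat \<Rightarrow> real"
    and V :: "nat \<Rightarrow> 'a \<Rightarrow> nat \<Rightarrow> nat \<Rightarrow> real"
    and \<delta> :: real
    and T0 :: "nat \<Rightarrow> nat set"
    and \<psi> :: "nat \<Rightarrow> 'a \<Rightarrow> (nat \<Rightarrow> real) \<Rightarrow> nat \<Rightarrow> real"
    and c :: "nat \<Rightarrow> 'a \<Rightarrow> real"
    and \<theta>min :: "nat \<Rightarrow> ereal"
  defines "T0 \<equiv> \<lambda>n. vsupport (p n) (\<theta>0 n)"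
    and "\<psi> \<equiv> \<lambda>n \<omega>. score n (p n) (\<lambda>t. Z n t \<omega>) (\<lambda>t. Y n t \<omega>)"
    and "c \<equiv> \<lambda>n \<omega>. linfnorm (p n) (vdiff (p n) (\<psi> n \<omega> (\<theta>hat n \<omega>)) (\<psi> n \<omega> (\<theta>0 n)))"
    and "\<theta>min \<equiv> \<lambda>n. min_signal (p n) (\<theta>0 n)"
  assumes model: "\<And>n. n \<ge> 1 \<Longrightarrow> linear_model (M n) n (p n) (\<theta>0 n) (Z n) (Y n) (\<epsilon> n) H (\<sigma> n) h0"
    and Theta: "\<And>n. n \<ge> 1 \<Longrightarrow> \<Theta> n \<subseteq> {..<p n} \<rightarrow>\<^sub>E UNIV"
    and theta0: "\<And>n. n \<ge> 1 \<Longrightarrow> \<theta>0 n \<in> \<Theta> n"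
    and sparse: "\<And>n. n \<ge> 1 \<Longrightarrow> card (T0 n) < n \<and> card (T0 n) < p n"
    and thetahat_measurable: "\<And>n. n \<ge> 1 \<Longrightarrow> \<theta>hat n \<in> M n \<rightarrow>\<^sub>M Rvec (p n)"
    and dantzig: "\<And>n \<omega>. n \<ge> 1 \<Longrightarrow> \<omega> \<in> space (M n) \<Longrightarrow>
          is_dantzig_selector (\<Theta> n) (p n) (\<psi> n \<omega>) (lam n) (\<theta>hat n \<omega>)"
    and V_measurable: "\<And>n i j. n \<ge> 1 \<Longrightarrow> i < p n \<Longrightarrow> j < p n \<Longrightarrow>
          (\<lambda>\<omega>. V n \<omega> i j) \<in> borel_measurable (M n)"
    and V_bound: "\<And>n \<omega> \<theta> v. n \<ge> 1 \<Longrightarrow> \<omega> \<in> space (M n) \<Longrightarrow> \<theta> \<in> \<Theta> n \<Longrightarrow>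
          v = vdiff (p n) \<theta> (\<theta>0 n) \<Longrightarrow> v \<in> l1cone (p n) (T0 n) \<Longrightarrow>
          \<bar>dotp (p n) v (vdiff (p n) (\<psi> n \<omega> \<theta>) (\<psi> n \<omega> (\<theta>0 n)))\<bar>
            \<ge> \<bar>dotp (p n) v (matvec (p n) (V n \<omega>) v)\<bar>"
    and a: "(\<lambda>n. measure (M n) {\<omega>\<in>space (M n). linfnorm (p n) (\<psi> n \<omega> (\<theta>0 n)) > lam n})
              \<longlonglongrightarrow> 0"
    and delta_pos: "\<delta> > 0"
    and b: "(\<lambda>n. measure (M n) {\<omega>\<in>space (M n). F_infty (p n) (T0 n) (V n \<omega>) > ereal \<delta>})
              \<longlonglongrightarrow> 1"
    and c: "\<And>n. n \<ge> 1 \<Longrightarrow> AE \<omega> in M n. \<theta>min n > ereal (4 * c n \<omega> / \<delta>)"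
  shows "(\<lambda>n. measure (M n) {\<omega>\<in>space (M n).
              linfnorm (p n) (vdiff (p n) (\<theta>hat n \<omega>) (\<theta>0 n)) > 2 / \<delta> * c n \<omega>}) \<longlonglongrightarrow> 0
    \<and> bigO_prob M (\<lambda>n \<omega>. linfnorm (p n) (vdiff (p n) (\<theta>hat n \<omega>) (\<theta>0 n))) lam
    \<and> ((\<forall>n\<ge>1. AE \<omega> in M n. ereal (2 * c n \<omega> / \<delta>) < ereal (\<tau> n) \<and> ereal (\<tau> n) < \<theta>min n / 2)
        \<longrightarrow> (\<lambda>n. measure (M n) {\<omega>\<in>space (M n).
              threshold_set (p n) (\<tau> n) (\<theta>hat n \<omega>) = T0 n}) \<longlonglongrightarrow> 1)"
proof -
  \<comment> \<open>\<open>A n\<close> is the vanishing event of (a) and \<open>E n\<close> the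
    likely event of (b); the deterministic bounds hold on \<open>G n\<close>.\<close>
  define A where "A n = {\<omega>\<in>space (M n). linfnorm (p n) (\<psi> n \<omega> (\<theta>0 n)) > lam n}" for n
  define E where "E n = {\<omega>\<in>space (M n). F_infty (p n) (T0 n) (V n \<omega>) > ereal \<delta>}" for n
  define G where "G n = E n - A n" for n
  define err where "err n \<omega> = linfnorm (p n) (vdiff (p n) (\<theta>hat n \<omega>) (\<theta>0 n))" for n \<omega>
  have prob: "prob_space (M n)" if "n \<ge> 1" for n
    using model[OF that] by (simp add: linear_model_def)
  \<comment> \<open>The strict bound \<open>card (T0 n) < p n\<close> excludes dimension 0, where
    \<open>linfnorm\<close> would be the maximum of an empty set.\<close>
  have p: "p n > 0" if "n \<ge> 1" for n
    using sparse[OF that] by linarith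
  have A_sets: "A n \<in> sets (M n)" if n: "n \<ge> 1" for n
  proof -
    have "{\<omega> \<in> space (M n). linfnorm (p n) (\<psi> n \<omega> (\<theta>0 n)) \<le> lam n} \<in> sets (M n)"
      unfolding \<psi>_def using score_measurable[OF model[OF n]] by (intro sets_linfnorm_le p n)
    then have "space (M n) - {\<omega> \<in> space (M n). linfnorm (p n) (\<psi> n \<omega> (\<theta>0 n)) \<le> lam n}
        \<in> sets (M n)"
      by (rule sets.compl_sets)
    also have "space (M n) - {\<omega> \<in> space (M n). linfnorm (p n) (\<psi> n \<omega> (\<theta>0 n)) \<le> lam n} = A n"
      by (auto simp: A_def)
    finally show ?thesis .
  qed
  \<comment> \<open>The measure of a non-measurable set is 0, so (b) makes \<open>E n\<close> eventually measurable.\<close>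
  have E_sets: "\<forall>\<^sub>F n in sequentially. E n \<in> sets (M n)"
  proof -
    have "\<forall>\<^sub>F n in sequentially. measure (M n) (E n) > 0"
      using b unfolding E_def[symmetric] by (rule order_tendstoD) simp
    then show ?thesis
      by eventually_elim (metis less_irrefl measure_notin_sets)
  qed
  have G_sets: "\<forall>\<^sub>F n in sequentially. n \<ge> 1 \<and> G n \<in> sets (M n)"
    using E_sets eventually_ge_at_top[of 1] by eventually_elim (auto simp: G_def A_sets)
  \<comment> \<open>Since \<open>E n\<close> is covered by \<open>G n\<close> and
    \<open>A n\<close>, the probability of \<open>G n\<close> lies between the difference of the
    other two and 1.\<close>
  have G_lim: "(\<lambda>n. measure (M n) (G n)) \<longlonglongrightarrow> 1"
  proof (rule tendsto_sandwich)
    show "\<forall>\<^sub>F n in sequentially. measure (M n) (E n) - measure (M n) (A n) \<le> measure (M n) (G n)"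
      using E_sets eventually_ge_at_top[of 1]
    proof eventually_elim
      case (elim n)
      interpret prob_space "M n" by (rule prob[OF elim(2)])
      have "prob (E n) \<le> prob (G n \<union> A n)"
        using elim A_sets by (intro finite_measure_mono) (auto simp: G_def)
      also have "\<dots> \<le> prob (G n) + prob (A n)"
        using elim A_sets by (intro measure_Un_le) (auto simp: G_def)
      finally show ?case by simp
    qed
    show "\<forall>\<^sub>F n in sequentially. measure (M n) (G n) \<le> 1"
      using eventually_ge_at_top[of 1] by eventually_elim (simp add: prob prob_space.prob_le_1)
    show "(\<lambda>n. measure (M n) (E n) - measure (M n) (A n)) \<longlonglongrightarrow> 1"
      using tendsto_diff[OF b a] by (simp add: A_def E_def)
  qed simp
  \<comment> \<open>Monotonicity asks for measurability of the larger set only, so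
    \<open>X n\<close> may be any set avoiding \<open>G n\<close>. The first two claims are
    instances.\<close>
  have compl_lim: "(\<lambda>n. measure (M n) (X n)) \<longlonglongrightarrow> 0"
    if X: "\<And>n. n \<ge> 1 \<Longrightarrow> X n \<subseteq> space (M n) - G n" for X
  proof (rule tendsto_sandwich[OF _ _ tendsto_const])
    show "\<forall>\<^sub>F n in sequentially. measure (M n) (X n) \<le> 1 - measure (M n) (G n)"
      using G_sets
    proof eventually_elim
      case (elim n)
      then interpret prob_space "M n" using prob by blast
      have "prob (X n) \<le> prob (space (M n) - G n)"
        using elim X by (intro finite_measure_mono) auto
      also have "\<dots> = 1 - prob (G n)"
        using elim by (intro prob_compl) auto
      finally show ?case .
    qed
    show "(\<lambda>n. 1 - measure (M n) (G n)) \<longlonglongrightarrow> 0"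
      using tendsto_diff[OF tendsto_const[of 1] G_lim] by simp
  qed auto
  have bounds: "err n \<omega> \<le> 2 / \<delta> * c n \<omega>" "err n \<omega> \<le> 4 / \<delta> * lam n"
    if n: "n \<ge> 1" and \<omega>: "\<omega> \<in> G n" for n \<omega>
  proof -
    have sp: "\<omega> \<in> space (M n)" and feas: "linfnorm (p n) (\<psi> n \<omega> (\<theta>0 n)) \<le> lam n"
      and F: "F_infty (p n) (vsupport (p n) (\<theta>0 n)) (V n \<omega>) > ereal \<delta>"
      using \<omega> by (auto simp: G_def E_def A_def T0_def)
    note V = V_bound[OF n sp, unfolded T0_def]
    show "err n \<omega> \<le> 2 / \<delta> * c n \<omega>" "err n \<omega> \<le> 4 / \<delta> * lam n"
      unfolding err_def c_def
      by (rule dantzig_selector_bounds[OF p[OF n] dantzig[OF n sp] theta0[OF n] feas F delta_pos V];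
          assumption)+
  qed
  have "(\<lambda>n. measure (M n) {\<omega>\<in>space (M n). err n \<omega> > 2 / \<delta> * c n \<omega>}) \<longlonglongrightarrow> 0"
    using bounds(1) by (intro compl_lim) (auto simp: not_less[symmetric])
  moreover have "bigO_prob M err lam"
    unfolding bigO_prob_def
  \<comment> \<open>A single constant serves every \<open>\<eta>\<close>, because the exceedance
    probability tends to 0.\<close>
  proof (intro allI impI exI[of _ "4 / \<delta>"] conjI)
    fix \<eta> :: real assume "\<eta> > 0"
    have "\<bar>err n \<omega>\<bar> = err n \<omega>" if "n \<ge> 1" for n \<omega>
      unfolding err_def using linfnorm_nonneg[OF p[OF that]] by simp
    then have "(\<lambda>n. measure (M n) {\<omega>\<in>space (M n). \<bar>err n \<omega>\<bar> > 4 / \<delta> * lam n}) \<longlonglongrightarrow> 0"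
      using bounds(2) by (intro compl_lim) (auto simp: not_less[symmetric])
    then show "\<forall>\<^sub>F n in sequentially.
        measure (M n) {\<omega>\<in>space (M n). \<bar>err n \<omega>\<bar> > 4 / \<delta> * lam n} < \<eta>"
      using \<open>\<eta> > 0\<close> by (rule order_tendstoD)
  qed (use delta_pos in simp)
  moreover have "(\<lambda>n. measure (M n) {\<omega>\<in>space (M n).
      threshold_set (p n) (\<tau> n) (\<theta>hat n \<omega>) = T0 n}) \<longlonglongrightarrow> 1"
    if \<tau>: "\<forall>n\<ge>1. AE \<omega> in M n. ereal (2 * c n \<omega> / \<delta>) < ereal (\<tau> n) \<and> ereal (\<tau> n) < \<theta>min n / 2"
  proof (rule tendsto_sandwich[OF _ _ G_lim tendsto_const])
    show "\<forall>\<^sub>F n in sequentially. measure (M n) (G n) \<le> measure (M n) {\<omega>\<in>space (M n).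
        threshold_set (p n) (\<tau> n) (\<theta>hat n \<omega>) = T0 n}"
      using eventually_ge_at_top[of 1]
    proof eventually_elim
      case (elim n)
      then interpret prob_space "M n" by (rule prob)
      \<comment> \<open>The threshold condition holds only almost surely, so \<open>G n\<close> is
        contained in the recovery event up to a null set; hence the almost-everywhere form of
        monotonicity below.\<close>
      have "AE \<omega> in M n. \<omega> \<in> G n \<longrightarrow> \<omega> \<in> {\<omega>\<in>space (M n).
          threshold_set (p n) (\<tau> n) (\<theta>hat n \<omega>) = T0 n}"
        using \<tau>[rule_format, OF elim]
      proof eventually_elim
        case (elim \<omega>)
        show ?case
        proof
          assume "\<omega> \<in> G n"
          then have "threshold_set (p n) (\<tau> n) (\<theta>hat n \<omega>) = T0 n"
            \<comment> \<open>The error radius \<open>r\<close> is the first bound on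
              \<open>G n\<close>; the threshold condition places it below
              \<open>\<tau> n\<close>.\<close>
            unfolding T0_def using bounds(1)[OF \<open>n \<ge> 1\<close>] elim
            by (intro threshold_set_eq_vsupport[where r = "2 / \<delta> * c n \<omega>"])
              (auto simp: err_def \<theta>min_def)
          with \<open>\<omega> \<in> G n\<close> show "\<omega> \<in> {\<omega>\<in>space (M n).
              threshold_set (p n) (\<tau> n) (\<theta>hat n \<omega>) = T0 n}"
            by (auto simp: G_def E_def)
        qed
      qed
      then show ?case
        unfolding T0_def
        using sets_threshold_set_eq[OF thetahat_measurable[OF elim]]
        by (intro finite_measure_mono_AE) auto
    qed
    show "\<forall>\<^sub>F n in sequentially. measure (M n) {\<omega>\<in>space (M n).
        threshold_set (p n) (\<tau> n) (\<theta>hat n \<omega>) = T0 n} \<le> 1"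
      using eventually_ge_at_top[of 1] by eventually_elim (simp add: prob prob_space.prob_le_1)
  qed
  ultimately show ?thesis
    unfolding err_def by blast
qed

end
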